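(* Let $S=\langle a_1,\dots,a_n\rangle\subseteq\mathbb{N}^d$ be an MPD-semigroup minimally generated by $a_1,\dots,a_n$, and let $G(S)$ be the subgroup of $\mathbb{Z}^d$ generated by $S$. If $\mathrm{rank}\,G(S)>1$, then for every $f\in\mathrm{PF}(S)$ every row-factorization matrix of $f$ has determinant zero.
   Context: $\mathbb{N}$ denotes the non-negative integers. An affine semigroup $S$ is a finitely generated submonoid of $\mathbb{N}^d$, with minimal generating set $\{a_1,\dots,a_n\}$. Put $\mathrm{cone}(S)=\{\sum_{i=1}^n\lambda_i a_i\mid \lambda_i\in\mathbb{Q}_{\ge 0}\}$ and $\mathcal{H}(S)=(\mathrm{cone}(S)\setminus S)\cap\mathbb{N}^d$. The set of pseudo-Frobenius elements is $\mathrm{PF}(S)=\{f\in\mathcal{H}(S)\mid f+s\in S \text{ for all } s\in S\setminus\{0\}\}$. $S$ is an MPD-semigroup if $\mathrm{PF}(S)\neq\emptyset$ (for $n\ge 2$ equivalently, the semigroup ring $k[S]$ has projective dimension $n-1$ over $k[x_1,\dots,x_n]$). For $f\in\mathrm{PF}(S)$, a row-factorization matrix (RF-matrix) of $f$ is an $n\times n$ integer matrix $M=(m_{ij})$ with $m_{ii}=-1$ for every $i$, $m_{ij}\in\mathbb{N}$ for $i\neq j$, and $\sum_{j=1}^n m_{ij}a_j=f$ for every $i=1,\dots,n$. *)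

theory Defs
  imports "HOL-Analysis.Analysis" "HOL-Computational_Algebra.Group_Closure"
begin

inductive_set monoid_closure :: "'a::comm_monoid_add set \<Rightarrow> 'a set" for A where
  base: "s \<in> insert 0 A \<Longrightarrow> s \<in> monoid_closure A"
| add: "s \<in> monoid_closure A \<Longrightarrow> t \<in> monoid_closure A \<Longrightarrow> s + t \<in> monoid_closure A"

text \<open>
  An affine semigroup is presented by a family \<open>a\<close> of generators in \<open>nat ^ 'd\<close>, where
  \<open>CARD('d)\<close> is the dimension and the index type \<open>'n\<close> has one element per generator.
\<close>

definition semigroup_of :: "('n::finite \<Rightarrow> nat ^ 'd) \<Rightarrow> (nat ^ 'd) set" where
  "semigroup_of a = monoid_closure (range a)"

definition minimal_generators :: "('n::finite \<Rightarrow> nat ^ 'd) \<Rightarrow> bool" where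
  "minimal_generators a \<longleftrightarrow>
     inj a \<and> (\<forall>B. B \<subset> range a \<longrightarrow> monoid_closure B \<noteq> semigroup_of a)"

definition of_nat_vec :: "nat ^ 'd \<Rightarrow> 'r::semiring_1 ^ 'd" where
  "of_nat_vec v = (\<chi> i. of_nat (v $ i))"

definition rat_cone :: "('n::finite \<Rightarrow> nat ^ 'd) \<Rightarrow> (rat ^ 'd) set" where
  "rat_cone a = {\<Sum>i\<in>UNIV. c i *s of_nat_vec (a i) | c. \<forall>i. 0 \<le> c i}"

definition semigroup_gaps :: "('n::finite \<Rightarrow> nat ^ 'd) \<Rightarrow> (nat ^ 'd) set" where
  "semigroup_gaps a = {h. of_nat_vec h \<in> rat_cone a \<and> h \<notin> semigroup_of a}"

definition pseudo_Frobenius :: "('n::finite \<Rightarrow> nat ^ 'd) \<Rightarrow> (nat ^ 'd) set" where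
  "pseudo_Frobenius a =
     {f \<in> semigroup_gaps a. \<forall>s \<in> semigroup_of a - {0}. f + s \<in> semigroup_of a}"

definition MPD_semigroup :: "('n::finite \<Rightarrow> nat ^ 'd) \<Rightarrow> bool" where
  "MPD_semigroup a \<longleftrightarrow> pseudo_Frobenius a \<noteq> {}"

definition RF_matrix :: "('n::finite \<Rightarrow> nat ^ 'd) \<Rightarrow> nat ^ 'd \<Rightarrow> int ^ 'n ^ 'n \<Rightarrow> bool" where
  "RF_matrix a f M \<longleftrightarrow>
     (\<forall>i. M $ i $ i = -1) \<and>
     (\<forall>i j. i \<noteq> j \<longrightarrow> 0 \<le> M $ i $ j) \<and>
     (\<forall>i. (\<Sum>j\<in>UNIV. M $ i $ j *s of_nat_vec (a j)) = of_nat_vec f)"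

definition group_of :: "('n::finite \<Rightarrow> nat ^ 'd) \<Rightarrow> (int ^ 'd) set" where
  "group_of a = group_closure (of_nat_vec ` semigroup_of a)"

interpretation int_vec: module "(*s) :: int \<Rightarrow> int ^ 'd \<Rightarrow> int ^ 'd"
  by unfold_locales (vector algebra_simps)+

text \<open>
  The rank of a subgroup of \<open>int ^ 'd\<close> is the largest size of a linearly independent subset over
  the integers; the maximum exists by \<open>finite_int_independent_cards\<close> below.
\<close>

definition group_rank :: "(int ^ 'd) set \<Rightarrow> nat" where
  "group_rank G = Max {card B | B. finite B \<and> B \<subseteq> G \<and> int_vec.independent B}"

lemma common_denominator:
  fixes u :: "'a \<Rightarrow> rat"
  assumes "finite t"
  shows "\<exists>D w. D \<noteq> (0::int) \<and> (\<forall>v\<in>t. of_int D * u v = of_int (w v))"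
  using assms
proof induction
  case empty
  show ?case by (intro exI[of _ 1]) auto
next
  case (insert x t)
  then obtain D w where D: "D \<noteq> 0" "\<And>v. v \<in> t \<Longrightarrow> of_int D * u v = of_int (w v)" by blast
  obtain p q where pq: "quotient_of (u x) = (p, q)" by force
  then have q: "q > 0" "u x = of_int p / of_int q"
    using quotient_of_denom_pos quotient_of_div by auto
  have "of_int (D * q) * u v = of_int (if v = x then D * p else q * w v)"
    if "v \<in> insert x t" for v
    using that q D(2)[of v] by (auto simp: field_simps)
  then show ?case using D(1) q(1)
    by (intro exI[of _ "D * q"] exI[of _ "\<lambda>v. if v = x then D * p else q * w v"]) auto
qed

lemma int_independent_card_le:
  fixes B :: "(int ^ 'd) set"
  assumes ind: "int_vec.independent B"
  shows "card B \<le> CARD('d)"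
proof -
  define e :: "int ^ 'd \<Rightarrow> rat ^ 'd" where "e = (\<lambda>v. \<chi> i. of_int (v $ i))"
  have inj: "inj e" by (auto simp: inj_def e_def vec_eq_iff)
  have "vec.independent (e ` B)"
    unfolding vec.independent_explicit_module
  proof (intro allI impI)
    fix t u v
    assume t: "finite t" "t \<subseteq> e ` B" and z: "(\<Sum>v\<in>t. u v *s v) = 0" and v: "v \<in> t"
    obtain T where T: "t = e ` T" "T \<subseteq> B" using t(2) by (meson subset_imageE)
    have fT: "finite T" using t(1) T inj by (metis finite_imageD inj_on_subset subset_UNIV)
    from v T obtain y where y: "y \<in> T" "v = e y" by blast
    obtain D w where D: "D \<noteq> 0" "\<And>x. x \<in> T \<Longrightarrow> of_int D * u (e x) = of_int (w x)"
      using common_denominator[OF fT, of "\<lambda>x. u (e x)"] by blast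
    have "(\<Sum>x\<in>T. w x *s x) = 0"
    proof (subst vec_eq_iff, intro allI)
      fix i
      have "(\<Sum>x\<in>T. u (e x) *s e x) = 0"
        using z T inj by (simp add: sum.reindex inj_on_subset[OF inj])
      then have "(\<Sum>x\<in>T. u (e x) *s e x) $ i = 0" by simp
      then have "of_int D * (\<Sum>x\<in>T. u (e x) * of_int (x $ i)) = 0"
        by (simp add: sum_component e_def)
      moreover have "of_int D * (\<Sum>x\<in>T. u (e x) * of_int (x $ i))
          = (\<Sum>x\<in>T. of_int (w x) * of_int (x $ i))"
        unfolding sum_distrib_left by (rule sum.cong) (auto simp: D(2)[symmetric] mult.assoc)
      ultimately have "(of_int (\<Sum>x\<in>T. w x * x $ i) :: rat) = 0" by simp
      then show "(\<Sum>x\<in>T. w x *s x) $ i = 0 $ i"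
        by (simp only: of_int_eq_0_iff) (simp add: sum_component)
    qed
    then have "w y = 0" using int_vec.independentD[OF ind fT T(2)] y(1) by blast
    then show "u v = 0" using D(1) D(2)[OF y(1)] y(2) by simp
  qed
  then have "card (e ` B) \<le> vec.dim (UNIV :: (rat ^ 'd) set)"
    by (intro vec.independent_card_le_dim) auto
  then show ?thesis using inj by (simp add: card_image inj_on_subset card_cart_basis)
qed

lemma finite_int_independent_cards:
  "finite {card B | B. finite B \<and> B \<subseteq> G \<and> int_vec.independent (B :: (int ^ 'd) set)}"
  by (rule finite_subset[of _ "{..CARD('d)}"]) (auto intro: int_independent_card_le)

end

theory Submission
  imports Defs
begin

text \<open>
  The RF equations say that \<open>M A\<close> has all rows equal to \<open>f\<close>, where \<open>A\<close> is the matrix with rows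
  \<open>a j\<close>. If \<open>det M \<noteq> 0\<close>, inverting \<open>M\<close> over the reals shows that each \<open>a j\<close> is a real multiple
  of \<open>f\<close>, so the group generated by the \<open>a j\<close> lies on a line and has rank at most one.
\<close>

text \<open>Membership of an integer vector in the real span of \<open>w\<close>. The scalar is real
  because the inverse of an integer matrix need not be integral.\<close>

definition on_line :: "real ^ 'd \<Rightarrow> int ^ 'd \<Rightarrow> bool" where
  "on_line w v \<longleftrightarrow> (\<exists>c. \<forall>k. of_int (v $ k) = c * w $ k)"

lemma on_line_0: "on_line w 0"
  unfolding on_line_def by (intro exI[of _ 0]) simp

lemma on_line_add:
  assumes "on_line w u" "on_line w v"
  shows "on_line w (u + v)"
proof -
  obtain b c where "\<forall>k. of_int (u $ k) = b * w $ k" "\<forall>k. of_int (v $ k) = c * w $ k"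
    using assms unfolding on_line_def by blast
  then show ?thesis
    unfolding on_line_def by (intro exI[of _ "b + c"]) (simp add: distrib_right)
qed

lemma on_line_diff:
  assumes "on_line w u" "on_line w v"
  shows "on_line w (u - v)"
proof -
  obtain b c where "\<forall>k. of_int (u $ k) = b * w $ k" "\<forall>k. of_int (v $ k) = c * w $ k"
    using assms unfolding on_line_def by blast
  then show ?thesis
    unfolding on_line_def by (intro exI[of _ "b - c"]) (simp add: left_diff_distrib)
qed

text \<open>The integer vectors on a line form a subgroup, so the property passes from the
  generators first to the semigroup and then to its group closure.\<close>

lemma group_of_on_line:
  fixes a :: "'n::finite \<Rightarrow> nat ^ 'd"
  assumes gens: "\<And>j. on_line w (of_nat_vec (a j))"
    and v: "v \<in> group_of a"
  shows "on_line w v"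
proof -
  have semigroup: "on_line w (of_nat_vec s)" if "s \<in> semigroup_of a" for s
    using that unfolding semigroup_of_def
  proof induction
    case (base s)
    moreover have "of_nat_vec 0 = (0 :: int ^ 'd)"
      by (simp add: of_nat_vec_def vec_eq_iff)
    ultimately show ?case using gens on_line_0[of w] by auto
  next
    case (add s t)
    have "of_nat_vec (s + t) = (of_nat_vec s + of_nat_vec t :: int ^ 'd)"
      by (simp add: of_nat_vec_def vec_eq_iff)
    then show ?case using add.IH on_line_add by simp
  qed
  show ?thesis using v unfolding group_of_def
  proof induction
    case (base s)
    then show ?case using semigroup on_line_0 by auto
  next
    case (diff s t)
    then show ?case using on_line_diff by blast
  qed
qed

text \<open>For parallel \<open>u\<close> and \<open>v\<close>, each coordinate \<open>k\<close>
  yields the integer relation \<open>v $ k *s u - u $ k *s v = 0\<close>. Independence forces the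
  coefficient of \<open>v\<close> to vanish for every \<open>k\<close>, hence \<open>u = 0\<close>,
  which no independent set contains.\<close>

lemma on_line_dependent:
  assumes "on_line w u" "on_line w v" "u \<noteq> v" "u \<in> B" "v \<in> B"
  shows "\<not> int_vec.independent B"
proof
  assume ind: "int_vec.independent B"
  obtain b c where b: "\<And>k. of_int (u $ k) = b * w $ k" and c: "\<And>k. of_int (v $ k) = c * w $ k"
    using assms unfolding on_line_def by blast
  \<comment> \<open>Over the reals both sides equal \<open>b * c * w $ k * w $ l\<close>.\<close>
  have cross: "v $ k * u $ l = u $ k * v $ l" for k l
  proof -
    have "(of_int (v $ k * u $ l) :: real) = of_int (u $ k * v $ l)"
      by (simp add: b c)
    then show ?thesis by (simp only: of_int_eq_iff)
  qed
  have "u $ k = 0" for k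
  proof -
    define p where "p = (\<lambda>x. if x = u then v $ k else - u $ k)"
    have "(\<Sum>x\<in>{u, v}. p x *s x) = 0"
    proof -
      have "(\<Sum>x\<in>{u, v}. p x *s x) = v $ k *s u + (- u $ k) *s v"
        using assms(3) by (simp add: p_def)
      also have "\<dots> = 0" by (simp add: vec_eq_iff cross)
      finally show ?thesis .
    qed
    then have "p v = 0"
      using int_vec.independentD[OF ind, of "{u, v}" p v] assms(4,5) by auto
    then show ?thesis using assms(3) by (simp add: p_def)
  qed
  then have "u = 0" by (simp add: vec_eq_iff)
  then show False using ind assms(4) int_vec.dependent_zero by blast
qed

lemma group_rank_on_line:
  assumes "\<And>v. v \<in> G \<Longrightarrow> on_line w v"
  shows "group_rank G \<le> 1"
proof -
  have "card B \<le> 1" if "finite B" "B \<subseteq> G" "int_vec.independent B" for B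
  proof -
    have "u = v" if "u \<in> B" "v \<in> B" for u v
      using on_line_dependent[of w u v B] assms that \<open>B \<subseteq> G\<close> \<open>int_vec.independent B\<close> by blast
    then show ?thesis using card_le_Suc0_iff_eq[OF \<open>finite B\<close>] by simp
  qed
  \<comment> \<open>\<open>Max\<close> can be bounded elementwise only over a nonempty finite set;
    the empty set is an independent subset.\<close>
  moreover have "{card B | B. finite B \<and> B \<subseteq> G \<and> int_vec.independent B} \<noteq> {}"
    using int_vec.independent_empty by blast
  ultimately show ?thesis
    unfolding group_rank_def by (subst Max_le_iff[OF finite_int_independent_cards]) auto
qed

text \<open>The determinant is an integer polynomial in the entries, so it commutes with the ring
  homomorphism \<open>of_int\<close>.\<close>

lemma det_of_int:
  fixes M :: "int ^ 'n ^ 'n"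
  shows "det (\<chi> i j. of_int (M $ i $ j)) = (of_int (det M) :: 'r::comm_ring_1)"
  by (simp add: det_def)

lemma RF_matrix_on_line:
  fixes a :: "'n::finite \<Rightarrow> nat ^ 'd"
  assumes RF: "RF_matrix a f M" and det: "det M \<noteq> 0"
  shows "on_line (of_nat_vec f) (of_nat_vec (a j))"
proof -
  define R :: "real ^ 'n ^ 'n" where "R = (\<chi> i j. of_int (M $ i $ j))"
  define A :: "real ^ 'd ^ 'n" where "A = (\<chi> j. of_nat_vec (a j))"
  have "det R \<noteq> 0" using det by (simp add: R_def det_of_int)
  then obtain N where N: "N ** R = mat 1"
    using invertible_det_nz invertible_left_inverse by blast
  have rows: "(R ** A) $ i $ k = of_nat (f $ k)" for i k
  proof -
    have "(\<Sum>j\<in>UNIV. M $ i $ j *s of_nat_vec (a j)) $ k = (of_nat_vec f :: int ^ 'd) $ k"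
      using RF unfolding RF_matrix_def by simp
    then have "(\<Sum>j\<in>UNIV. M $ i $ j * int (a j $ k)) = int (f $ k)"
      by (simp add: of_nat_vec_def)
    then have "real_of_int (\<Sum>j\<in>UNIV. M $ i $ j * int (a j $ k)) = of_nat (f $ k)"
      by simp
    then show ?thesis
      by (simp add: matrix_matrix_mult_def R_def A_def of_nat_vec_def)
  qed
  \<comment> \<open>Every entry in column \<open>k\<close> of \<open>R ** A\<close> is
    \<open>f $ k\<close>, so it factors out of row \<open>j\<close> of \<open>N ** (R ** A)\<close>.
    The scalar is thus the sum of row \<open>j\<close> of \<open>N\<close>, the same for all
    \<open>k\<close>.\<close>
  have "real (a j $ k) = (\<Sum>i\<in>UNIV. N $ j $ i) * real (f $ k)" for k
  proof -
    have "real (a j $ k) = (N ** (R ** A)) $ j $ k"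
      by (simp add: matrix_mul_assoc N A_def of_nat_vec_def)
    also have "\<dots> = (\<Sum>i\<in>UNIV. N $ j $ i * (R ** A) $ i $ k)"
      by (simp add: matrix_matrix_mult_def[of N])
    finally show ?thesis by (simp add: rows sum_distrib_right)
  qed
  then show ?thesis unfolding on_line_def by (auto simp: of_nat_vec_def)
qed

theorem theorem5p2:
  fixes a :: "'n::finite \<Rightarrow> nat ^ 'd"
  assumes "minimal_generators a"
    and "MPD_semigroup a"
    and "group_rank (group_of a) > 1"
  shows "\<forall>f \<in> pseudo_Frobenius a. \<forall>M. RF_matrix a f M \<longrightarrow> det M = 0"
proof (intro ballI allI impI, rule ccontr)
  fix f M
  assume RF: "RF_matrix a f M" and det: "det M \<noteq> 0"
  have "group_rank (group_of a) \<le> 1"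
    by (rule group_rank_on_line[OF group_of_on_line[OF RF_matrix_on_line[OF RF det]]])
  then show False using assms(3) by simp
qed

end
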